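(* Let $X$ be a partially ordered set, $\Lambda$ a totally ordered set and $u:X\to\Lambda$ a quasi-Leontief function. Then, for every comprehensive, nonempty, chain upper closed (CUC) and bounded above subset $S$ of $X$, $$\mathrm{Max}(S)\cap\arg\max(u;S)\neq\emptyset,$$ and consequently $\max_{x\in S}u(x)=\max_{x\in\mathrm{Max}(S)}u(x)$.
   Context: $u:X\to\Lambda$ is quasi-Leontief if for every $x\in X$ there is $x^\circ\in X$ with $\{x'\in X:u(x')\geqslant u(x)\}=\{x'\in X:x'\geqslant x^\circ\}$. $S$ is comprehensive if $x'\in S$ and $x\leqslant x'$ imply $x\in S$. $S$ is bounded above if it has an upper bound in $X$. A chain is a nonempty totally ordered subset. $S\subset X$ is chain upper closed (CUC) if every chain $\mathcal C$ in $S$ that has an upper bound in $X$ has a least upper bound $\sup\mathcal C$ and that least upper bound belongs to $S$. $\mathrm{Max}(S)$ is the set of maximal elements of $S$, i.e. of $\bar x\in S$ with $\{x\in S:x\geqslant\bar x\}=\{\bar x\}$. $\arg\max(u;S)=\{x\in S:u(x)\geqslant u(x')\text{ for all }x'\in S\}$. *)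

theory Defs
  imports Complex_Main "HOL-Library.Lub_Glb"
begin

definition quasi_Leontief :: "('a::order \<Rightarrow> 'b::linorder) \<Rightarrow> bool" where
  "quasi_Leontief u \<longleftrightarrow> (\<forall>x. \<exists>x0. {x'. u x' \<ge> u x} = {x'. x' \<ge> x0})"

definition comprehensive :: "'a::order set \<Rightarrow> bool" where
  "comprehensive S \<longleftrightarrow> (\<forall>x x'. x' \<in> S \<and> x \<le> x' \<longrightarrow> x \<in> S)"

text \<open>
  The library predicate \<^const>\<open>Complete_Partial_Order.chain\<close> admits the empty set, whereas
  chains are nonempty here; without \<open>C \<noteq> {}\<close> the condition would force a least element.
  Upper bounds and least upper bounds are taken in the whole ordered type.
\<close>
definition chain_upper_closed :: "'a::order set \<Rightarrow> bool" where
  "chain_upper_closed S \<longleftrightarrow>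
    (\<forall>C. C \<noteq> {} \<and> C \<subseteq> S \<and> Complete_Partial_Order.chain (\<le>) C \<and> bdd_above C \<longrightarrow>
      (\<exists>s. isLub UNIV C s \<and> s \<in> S))"

text \<open>
  The maximal elements of a subset of a partial order; not the operator \<^const>\<open>Max\<close>,
  which yields the greatest element of a finite linearly ordered set.
\<close>
definition maximal_elements :: "'a::order set \<Rightarrow> 'a set" where
  "maximal_elements S = {m \<in> S. {x \<in> S. x \<ge> m} = {m}}"

definition argmax_set :: "('a \<Rightarrow> 'b::linorder) \<Rightarrow> 'a set \<Rightarrow> 'a set" where
  "argmax_set u S = {x \<in> S. \<forall>x'\<in>S. u x \<ge> u x'}"

text \<open>
  The maximum of \<open>u\<close> over \<open>S\<close> exists and is \<open>v\<close>.  It is a relation because the maximum of a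
  function over an infinite set need not exist; \<open>v\<close> is unique by antisymmetry.
\<close>
definition is_max_value :: "('a \<Rightarrow> 'b::linorder) \<Rightarrow> 'a set \<Rightarrow> 'b \<Rightarrow> bool" where
  "is_max_value u S v \<longleftrightarrow> v \<in> u ` S \<and> (\<forall>x\<in>S. u x \<le> v)"

end

theory Submission
  imports Defs
begin

text \<open>
  The map sending \<open>x\<close> to \<open>x\<degree>\<close> takes \<open>S\<close> into itself by comprehensiveness, and its image is a
  chain because the upper level sets of \<open>u\<close> are nested.  The least upper bound of that chain lies
  in \<open>S\<close> and maximizes \<open>u\<close>.  Zorn's lemma puts a maximal element of \<open>S\<close> above it, which is also
  a maximizer since \<open>u\<close> is increasing.
\<close>

text \<open>The upper level set of \<open>x\<close> at its own value is a principal up-set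
  containing \<open>x\<close>, so it contains everything above \<open>x\<close>.\<close>

lemma quasi_Leontief_mono:
  fixes u :: "'a::order \<Rightarrow> 'b::linorder"
  assumes "quasi_Leontief u"
  shows "mono u"
proof
  fix x y :: 'a
  assume "x \<le> y"
  obtain x0 where x0: "{x'. u x' \<ge> u x} = {x'. x' \<ge> x0}"
    using assms unfolding quasi_Leontief_def by blast
  then have "x0 \<le> x" by blast
  with \<open>x \<le> y\<close> have "x0 \<le> y" by order
  with x0 show "u x \<le> u y" by blast
qed

lemma argmax_set_nonempty:
  assumes "quasi_Leontief u" "comprehensive S" "S \<noteq> {}" "chain_upper_closed S" "bdd_above S"
  shows "argmax_set u S \<noteq> {}"
proof -
  obtain c where "\<forall>x. {x'. u x' \<ge> u x} = {x'. x' \<ge> c x}"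
    using choice[OF assms(1)[unfolded quasi_Leontief_def]] by (rule exE)
  \<comment> \<open>This Galois-like equivalence turns comparisons of values into comparisons in the
    order of \<open>'a\<close>; the steps below use \<open>u\<close> only through it.\<close>
  then have c: "u x \<le> u x' \<longleftrightarrow> c x \<le> x'" for x x'
    by (simp add: set_eq_iff)
  have below: "c x \<le> x" for x
    by (simp flip: c)
  then have sub: "c ` S \<subseteq> S"
    using assms(2) unfolding comprehensive_def by auto
  have "c x \<le> c y" if "u x \<le> u y" for x y
  proof -
    have "u y \<le> u (c y)"
      by (simp add: c)
    with that have "u x \<le> u (c y)"
      by (rule order.trans)
    then show ?thesis
      by (simp add: c)
  qed
  then have "Complete_Partial_Order.chain (\<le>) (c ` S)"
    unfolding chain_def by (metis image_iff linear)
  moreover have "bdd_above (c ` S)"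
    using assms(5) sub by (rule bdd_above_mono)
  ultimately obtain s where "isLub UNIV (c ` S) s" "s \<in> S"
    using assms(3,4) sub unfolding chain_upper_closed_def by (meson image_is_empty)
  \<comment> \<open>By \<open>c\<close>, being above every \<open>c x\<close> with \<open>x\<close>
    in \<open>S\<close> says exactly that \<open>u s\<close> dominates every
    \<open>u x\<close>.\<close>
  then have "s \<in> argmax_set u S"
    unfolding argmax_set_def by (simp add: c isLubD2)
  then show ?thesis by blast
qed

text \<open>Zorn's lemma is applied to the part of \<open>S\<close> above \<open>s\<close>, which
  forces the maximal element to lie above \<open>s\<close>.\<close>

lemma maximal_element_above:
  assumes "chain_upper_closed S" "bdd_above S" "s \<in> S"
  shows "\<exists>m\<in>maximal_elements S. s \<le> m"
proof -
  let ?A = "{x \<in> S. s \<le> x}"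
  have "\<exists>m\<in>?A. \<forall>a\<in>?A. m \<le> a \<longrightarrow> a = m"
  proof (rule predicate_Zorn)
    show "partial_order_on ?A (relation_of (\<le>) ?A)"
      by (rule partial_order_on_relation_ofI) auto
  next
    fix C assume "C \<in> Chains (relation_of (\<le>) ?A)"
    then have sub: "C \<subseteq> ?A" and "Complete_Partial_Order.chain (\<le>) C"
      unfolding Chains_def relation_of_def chain_def by auto
    show "\<exists>b\<in>?A. \<forall>a\<in>C. a \<le> b"
    proof (cases "C = {}")
      \<comment> \<open>Chain upper closedness covers only nonempty chains; here \<open>s\<close>
        itself serves as the bound.\<close>
      case True
      with assms(3) show ?thesis by auto
    next
      case False
      have "bdd_above C"
        by (rule bdd_above_mono[OF assms(2)]) (use sub in auto)
      with False sub \<open>Complete_Partial_Order.chain (\<le>) C\<close>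
      obtain b where "isLub UNIV C b" "b \<in> S"
        using assms(1) unfolding chain_upper_closed_def by blast
      then have "\<forall>a\<in>C. a \<le> b" by (simp add: isLubD2)
      \<comment> \<open>Any member of the nonempty chain lies between \<open>s\<close> and
        \<open>b\<close>, which puts \<open>b\<close> in \<open>?A\<close>.\<close>
      moreover obtain a where "a \<in> C"
        using False by blast
      with sub have "s \<le> a" by blast
      with calculation \<open>a \<in> C\<close> have "s \<le> b"
        using order.trans by metis
      ultimately show ?thesis using \<open>b \<in> S\<close> by blast
    qed
  qed
  then obtain m where "m \<in> S" "s \<le> m" and max: "\<And>a. a \<in> S \<Longrightarrow> s \<le> a \<Longrightarrow> m \<le> a \<Longrightarrow> a = m"
    by blast
  \<comment> \<open>Whatever in \<open>S\<close> is above \<open>m\<close> is also above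
    \<open>s\<close>, so maximality in \<open>?A\<close> is maximality in \<open>S\<close>.\<close>
  then have "m \<in> maximal_elements S"
    using max[OF _ order.trans[OF \<open>s \<le> m\<close>]] unfolding maximal_elements_def by auto
  with \<open>s \<le> m\<close> show ?thesis by blast
qed

theorem theorem2p4p3:
  fixes u :: "'a::order \<Rightarrow> 'b::linorder"
    and S :: "'a set"
  assumes "quasi_Leontief u"
    and "comprehensive S"
    and "S \<noteq> {}"
    and "chain_upper_closed S"
    and "bdd_above S"
  shows "maximal_elements S \<inter> argmax_set u S \<noteq> {} \<and>
    (\<exists>v. is_max_value u S v \<and> is_max_value u (maximal_elements S) v)"
proof -
  obtain s where s: "s \<in> argmax_set u S"
    using argmax_set_nonempty[OF assms] by blast
  then obtain m where m: "m \<in> maximal_elements S" and "s \<le> m"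
    using maximal_element_above[OF assms(4,5)] unfolding argmax_set_def by blast
  have "u s \<le> u m"
    using quasi_Leontief_mono[OF assms(1)] \<open>s \<le> m\<close> by (rule monoD)
  with s have "u x \<le> u m" if "x \<in> S" for x
    using that unfolding argmax_set_def by fastforce
  with m have am: "m \<in> argmax_set u S"
    unfolding argmax_set_def maximal_elements_def by simp
  \<comment> \<open>The value \<open>u m\<close> bounds \<open>u\<close> on \<open>S\<close>, hence
    on its maximal elements, and \<open>m\<close> attains it in both sets.\<close>
  with m have "is_max_value u S (u m)" "is_max_value u (maximal_elements S) (u m)"
    unfolding is_max_value_def argmax_set_def maximal_elements_def by auto
  with m am show ?thesis by blast
qed

end
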